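(* For every integer $n \ge 5$, there exists an instance of $(QP)$ with $n$ variables such that $-\infty < \ell^* < +\infty$, whereas, with $\mathcal{K} = \mathcal{D}^{n+1}$, $\ell_{\mathcal{K}}(\tilde{x}) = -\infty$ for each $\tilde{x} \in S$, and $\ell_{\mathcal{K}} = -\infty$.
   Context: An instance of $(QP)$ with $n$ variables consists of a positive integer $m$, a symmetric $Q \in \mathbb{R}^{n\times n}$, $c \in \mathbb{R}^n$, $A \in \mathbb{R}^{m \times n}$, $b \in \mathbb{R}^m$; put $q(x) = x^T Q x + 2c^T x$ and $S = \{x \in \mathbb{R}^n : Ax = b,\ x \ge 0\}$. $(QP)$ is the problem of minimizing $q(x)$ over $x \in S$, with optimal value (infimum) $\ell^*$, where $\ell^* = +\infty$ if $S = \emptyset$ and $\ell^* = -\infty$ if $q$ is unbounded below on $S$. $\mathcal{S}^N$ denotes the real symmetric $N\times N$ matrices, and $\langle U,V\rangle = \sum_{i,j} U_{ij}V_{ij}$. $\mathcal{D}^N$ is the cone of doubly nonnegative matrices (positive semidefinite and entrywise nonnegative) in $\mathcal{S}^N$. Rows and columns of matrices in $\mathcal{S}^{n+1}$ are indexed by $0,1,\ldots,n$. Let \[ \widehat{Q} = \begin{bmatrix} 0 & c^T \\ c & Q\end{bmatrix}, \qquad \widehat{A} = \begin{bmatrix} b^Tb & -b^TA \\ -A^Tb & A^TA\end{bmatrix}. \] $(P(\mathcal{K}))$: minimize $\langle \widehat{Q}, Y\rangle$ subject to $\langle \widehat{A}, Y\rangle = 0$, $Y_{00} = 1$, $Y \in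 \mathcal{K}$; its optimal value (infimum) is $\ell_{\mathcal{K}}$. For $\tilde{x} \in S$, $(P(\mathcal{K},\tilde{x}))$ is the same problem with the additional constraint that $(Y_{01},\ldots,Y_{0n}) = \tilde{x}^T$; its optimal value (infimum) is $\ell_{\mathcal{K}}(\tilde{x})$. *)

theory Defs
  imports "Jordan_Normal_Form.Matrix" "HOL-Library.Extended_Real"
begin

definition qp_instance ::
  "nat \<Rightarrow> nat \<Rightarrow> real mat \<Rightarrow> real vec \<Rightarrow> real mat \<Rightarrow> real vec \<Rightarrow> bool" where
  "qp_instance n m Q c A b \<longleftrightarrow>
     m > 0 \<and> Q \<in> carrier_mat n n \<and> transpose_mat Q = Q \<and> c \<in> carrier_vec n \<and>
     A \<in> carrier_mat m n \<and> b \<in> carrier_vec m"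

definition qp_objective :: "real mat \<Rightarrow> real vec \<Rightarrow> real vec \<Rightarrow> real" where
  "qp_objective Q c x = x \<bullet> (Q *\<^sub>v x) + 2 * (c \<bullet> x)"

definition qp_feasible :: "nat \<Rightarrow> real mat \<Rightarrow> real vec \<Rightarrow> real vec set" where
  "qp_feasible n A b = {x \<in> carrier_vec n. A *\<^sub>v x = b \<and> 0\<^sub>v n \<le> x}"

text \<open>Optimal values are infima in the extended reals, so that an infeasible problem has
  value \<open>\<infinity>\<close> and a problem that is unbounded below has value \<open>-\<infinity>\<close>.\<close>

definition qp_value :: "nat \<Rightarrow> real mat \<Rightarrow> real vec \<Rightarrow> real mat \<Rightarrow> real vec \<Rightarrow> ereal" where
  "qp_value n Q c A b = (INF x \<in> qp_feasible n A b. ereal (qp_objective Q c x))"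

definition mat_inner :: "real mat \<Rightarrow> real mat \<Rightarrow> real" where
  "mat_inner U V = (\<Sum>i<dim_row U. \<Sum>j<dim_col U. U $$ (i, j) * V $$ (i, j))"

definition psd_mats :: "nat \<Rightarrow> real mat set" where
  "psd_mats N = {Y \<in> carrier_mat N N. transpose_mat Y = Y \<and>
     (\<forall>v \<in> carrier_vec N. 0 \<le> v \<bullet> (Y *\<^sub>v v))}"

definition doubly_nonneg :: "nat \<Rightarrow> real mat set" where
  "doubly_nonneg N = {Y \<in> psd_mats N. 0\<^sub>m N N \<le> Y}"

text \<open>The order on matrices and vectors is entrywise. In the block matrices below, index 0
  is the extra row and column, and \<open>mat_of_row c\<close> is the row vector $c^T$.\<close>

definition Q_hat :: "real mat \<Rightarrow> real vec \<Rightarrow> real mat" where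
  "Q_hat Q c = four_block_mat (0\<^sub>m 1 1) (mat_of_row c) (transpose_mat (mat_of_row c)) Q"

definition A_hat :: "real mat \<Rightarrow> real vec \<Rightarrow> real mat" where
  "A_hat A b = four_block_mat
     (mat_of_row b * transpose_mat (mat_of_row b))
     (- (mat_of_row b * A))
     (- (transpose_mat A * transpose_mat (mat_of_row b)))
     (transpose_mat A * A)"

definition conic_feasible :: "real mat set \<Rightarrow> real mat \<Rightarrow> real vec \<Rightarrow> real mat set" where
  "conic_feasible K A b = {Y \<in> K. mat_inner (A_hat A b) Y = 0 \<and> Y $$ (0, 0) = 1}"

definition conic_value ::
  "real mat set \<Rightarrow> real mat \<Rightarrow> real vec \<Rightarrow> real mat \<Rightarrow> real vec \<Rightarrow> ereal" where
  "conic_value K Q c A b = (INF Y \<in> conic_feasible K A b. ereal (mat_inner (Q_hat Q c) Y))"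

text \<open>The constraint $(Y_{01},\dots,Y_{0n}) = x^T$; entries of \<open>x\<close> are indexed from 0.\<close>

definition conic_feasible_at ::
  "real mat set \<Rightarrow> real mat \<Rightarrow> real vec \<Rightarrow> real vec \<Rightarrow> real mat set" where
  "conic_feasible_at K A b x =
     {Y \<in> conic_feasible K A b. \<forall>j < dim_vec x. Y $$ (0, Suc j) = x $ j}"

definition conic_value_at ::
  "real mat set \<Rightarrow> real mat \<Rightarrow> real vec \<Rightarrow> real mat \<Rightarrow> real vec \<Rightarrow> real vec \<Rightarrow> ereal" where
  "conic_value_at K Q c A b x =
     (INF Y \<in> conic_feasible_at K A b x. ereal (mat_inner (Q_hat Q c) Y))"

end

theory Submission
  imports Defs
begin

text \<open>Take \<open>A = 0\<close>, \<open>b = 0\<close>, \<open>c = 0\<close>, so that \<open>S\<close> is the nonnegative orthant, and let \<open>Q\<close> be the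
  Horn matrix padded with zeros. The Horn matrix is copositive, so the optimal value is 0, but it
  is not the sum of a positive semidefinite and a nonnegative matrix: it has a negative inner
  product with some doubly nonnegative \<open>D\<close>. Adding large multiples of \<open>D\<close> to the lower right block
  of the rank-one matrix generated by \<open>(1, x)\<close> drives the relaxation at \<open>x\<close> to \<open>-\<infinity>\<close>.\<close>

definition horn :: "nat \<Rightarrow> nat \<Rightarrow> real" where
  "horn i j = (if i < 5 \<and> j < 5
     then (if j = (i + 1) mod 5 \<or> i = (j + 1) mod 5 then -1 else 1) else 0)"

definition horn_mat :: "nat \<Rightarrow> real mat" where
  "horn_mat n = mat n n (\<lambda>(i, j). horn i j)"

text \<open>\<open>D\<close> is the square of the symmetric circulant matrix with first row \<open>(7, 5, -1, -1, 5)\<close>, that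
  is, the circulant matrix with first row \<open>(101, 61, 1, 1, 61)\<close>. Its inner product with the Horn
  matrix is \<open>5 (101 - 2 * 61 + 2 * 1) = -95\<close>.\<close>

definition circ :: "nat \<Rightarrow> nat \<Rightarrow> real" where
  "circ k i = (if i < 5 then [7, 5, -1, -1, 5] ! ((i + k) mod 5) else 0)"

text \<open>Row \<open>k\<close> of \<open>circ\<close> is shifted by \<open>+k\<close>, whereas a
  circulant shifts by \<open>-k\<close>. This only permutes the rows, so the Gram sum is the
  same.\<close>

definition dnn_cert :: "nat \<Rightarrow> nat \<Rightarrow> real" where
  "dnn_cert i j = (\<Sum>k<5. circ k i * circ k j)"

definition lifted :: "real vec \<Rightarrow> real \<Rightarrow> real mat" where
  "lifted x t = mat (dim_vec x + 1) (dim_vec x + 1) (\<lambda>(i, j).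
     vCons 1 x $ i * vCons 1 x $ j +
     t * (if i = 0 \<or> j = 0 then 0 else dnn_cert (i - 1) (j - 1)))"

lemma sum_lessThan_5: "(\<Sum>i<5. f i) = f 0 + f 1 + f 2 + f 3 + f (4::nat)" for f :: "nat \<Rightarrow> real"
  by (simp add: eval_nat_numeral)

lemma less_5_cases:
  assumes "i < (5::nat)"
  obtains "i = 0" | "i = 1" | "i = 2" | "i = 3" | "i = 4"
  using assms by linarith

lemma horn_sum:
  assumes "n \<ge> 5"
  shows "(\<Sum>i<n. \<Sum>j<n. horn i j * f i j) = (\<Sum>i<5. \<Sum>j<5. horn i j * f i j)"
proof -
  have "(\<Sum>j<n. horn i j * f i j) = (\<Sum>j<5. horn i j * f i j)" for i
    using assms by (intro sum.mono_neutral_right) (auto simp: horn_def)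
  moreover have "(\<Sum>i<n. \<Sum>j<5. horn i j * f i j) = (\<Sum>i<5. \<Sum>j<5. horn i j * f i j)"
    using assms by (intro sum.mono_neutral_right) (auto simp: horn_def)
  ultimately show ?thesis by simp
qed

text \<open>The form agrees with the square of a signed sum except at three products. The correction
  is nonnegative once the signs are chosen according to the order of \<open>x 3\<close> and
  \<open>x 4\<close>.\<close>

lemma horn_copositive:
  fixes x :: "nat \<Rightarrow> real"
  assumes "\<And>i. i < 5 \<Longrightarrow> x i \<ge> 0"
  shows "(\<Sum>i<5. \<Sum>j<5. horn i j * (x i * x j)) \<ge> 0"
proof -
  have nn: "x 0 \<ge> 0" "x 1 \<ge> 0" "x 2 \<ge> 0" "x 3 \<ge> 0" "x 4 \<ge> 0"
    using assms by auto
  have expand: "(\<Sum>i<5. \<Sum>j<5. horn i j * (x i * x j)) =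
      (x 0)\<^sup>2 + (x 1)\<^sup>2 + (x 2)\<^sup>2 + (x 3)\<^sup>2 + (x 4)\<^sup>2
      - 2 * (x 0 * x 1 + x 1 * x 2 + x 2 * x 3 + x 3 * x 4 + x 4 * x 0)
      + 2 * (x 0 * x 2 + x 1 * x 3 + x 2 * x 4 + x 3 * x 0 + x 4 * x 1)"
    by (simp add: sum_lessThan_5 horn_def power2_eq_square)
  show ?thesis
  proof (cases "x 3 \<le> x 4")
    case True
    have "(\<Sum>i<5. \<Sum>j<5. horn i j * (x i * x j)) =
        (x 0 - x 1 + x 2 + x 3 - x 4)\<^sup>2 + 4 * (x 1 * x 3) + 4 * (x 2 * (x 4 - x 3))"
      unfolding expand by (simp add: power2_eq_square algebra_simps)
    then show ?thesis using nn True by simp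
  next
    case False
    \<comment> \<open>The previous identity under the reflection of the 5-cycle that swaps 3 with 4
      and 0 with 2 and fixes 1.\<close>
    have "(\<Sum>i<5. \<Sum>j<5. horn i j * (x i * x j)) =
        (x 0 - x 1 + x 2 - x 3 + x 4)\<^sup>2 + 4 * (x 1 * x 4) + 4 * (x 0 * (x 3 - x 4))"
      unfolding expand by (simp add: power2_eq_square algebra_simps)
    then show ?thesis using nn False by simp
  qed
qed

text \<open>Since \<open>circ\<close> has negative entries, the 25 entries of the Gram sum are
  evaluated one by one; outside that block every summand vanishes.\<close>

lemma dnn_cert_nonneg: "dnn_cert i j \<ge> 0"
proof (cases "i < 5 \<and> j < 5")
  case True
  then show ?thesis
    by (elim conjE less_5_cases[of i] less_5_cases[of j])
      (simp_all add: dnn_cert_def sum_lessThan_5 circ_def)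
next
  case False
  then show ?thesis by (auto simp: dnn_cert_def circ_def)
qed

lemma horn_dnn_cert: "(\<Sum>i<5. \<Sum>j<5. horn i j * dnn_cert i j) = -95"
  by (simp add: dnn_cert_def sum_lessThan_5 circ_def horn_def)

lemma quadratic_form_mat:
  fixes v :: "real vec"
  assumes "v \<in> carrier_vec N"
  shows "v \<bullet> (mat N N (\<lambda>(i, j). f i j) *\<^sub>v v) = (\<Sum>i<N. \<Sum>j<N. f i j * (v $ i * v $ j))"
  using assms
  by (auto simp: scalar_prod_def atLeast0LessThan sum_distrib_left intro!: sum.cong)

text \<open>Moving the sum over \<open>k\<close> outside leaves a sum of squares.\<close>

lemma gram_sum_nonneg:
  fixes f :: "'a \<Rightarrow> 'i \<Rightarrow> real"
  shows "(\<Sum>i\<in>I. \<Sum>j\<in>I. (\<Sum>k\<in>A. f k i * f k j) * (v i * v j)) \<ge> 0"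
proof -
  have "(\<Sum>i\<in>I. \<Sum>j\<in>I. (\<Sum>k\<in>A. f k i * f k j) * (v i * v j))
      = (\<Sum>i\<in>I. \<Sum>k\<in>A. \<Sum>j\<in>I. (f k i * v i) * (f k j * v j))"
    by (subst (2) sum.swap) (simp add: sum_distrib_left sum_distrib_right mult_ac)
  also have "\<dots> = (\<Sum>k\<in>A. \<Sum>i\<in>I. \<Sum>j\<in>I. (f k i * v i) * (f k j * v j))"
    by (rule sum.swap)
  also have "\<dots> = (\<Sum>k\<in>A. (\<Sum>i\<in>I. f k i * v i)\<^sup>2)"
    by (simp add: power2_eq_square sum_product)
  finally show ?thesis by (simp add: sum_nonneg)
qed

lemma lifted_doubly_nonneg:
  assumes "0\<^sub>v (dim_vec x) \<le> x" "t \<ge> 0"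
  shows "lifted x t \<in> doubly_nonneg (dim_vec x + 1)"
proof -
  define N where "N = dim_vec x + 1"
  define u where "u = (\<lambda>i. vCons 1 x $ i)"
  \<comment> \<open>\<open>circ\<close> moved past the extra index 0 and padded there with 0, so
    that the block containing D becomes a Gram sum of full size.\<close>
  define w where "w = (\<lambda>k i. if i = 0 then 0 else circ k (i - 1))"
  have cert: "(if i = 0 \<or> j = 0 then 0 else dnn_cert (i - 1) (j - 1)) = (\<Sum>k<5. w k i * w k j)"
    for i j by (auto simp: w_def dnn_cert_def)
  have lifted: "lifted x t = mat N N (\<lambda>(i, j). u i * u j + t * (\<Sum>k<5. w k i * w k j))"
    unfolding lifted_def N_def u_def cert ..
  have u_nonneg: "u i \<ge> 0" if "i < N" for i
    using assms(1) that by (cases i) (auto simp: u_def N_def less_eq_vec_def)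
  have "v \<bullet> (lifted x t *\<^sub>v v) \<ge> 0" if "v \<in> carrier_vec N" for v
  proof -
    have "v \<bullet> (lifted x t *\<^sub>v v)
        = (\<Sum>i<N. \<Sum>j<N. (u i * u j + t * (\<Sum>k<5. w k i * w k j)) * (v $ i * v $ j))"
      unfolding lifted by (rule quadratic_form_mat[OF that])
    \<comment> \<open>The sum over a singleton presents the rank-one part as a Gram sum too.\<close>
    also have "\<dots> = (\<Sum>i<N. \<Sum>j<N. (\<Sum>k\<in>{()}. u i * u j) * (v $ i * v $ j))
        + t * (\<Sum>i<N. \<Sum>j<N. (\<Sum>k<5. w k i * w k j) * (v $ i * v $ j))"
      by (simp add: distrib_right sum.distrib mult.assoc flip: sum_distrib_left)
    also have "\<dots> \<ge> 0"
      using gram_sum_nonneg[of "\<lambda>_. u"] gram_sum_nonneg[of w] assms(2)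
      by (intro add_nonneg_nonneg mult_nonneg_nonneg)
    finally show ?thesis .
  qed
  moreover have "transpose_mat (lifted x t) = lifted x t"
    by (auto simp: lifted mult.commute)
  moreover have "0\<^sub>m N N \<le> lifted x t"
    using u_nonneg assms(2) dnn_cert_nonneg
    by (auto simp: less_eq_mat_def lifted cert[symmetric])
  moreover have "lifted x t \<in> carrier_mat N N"
    by (simp add: lifted)
  ultimately show ?thesis
    by (simp add: doubly_nonneg_def psd_mats_def N_def)
qed

lemma mat_inner_Q_hat_zero:
  assumes "Q \<in> carrier_mat n n"
  shows "mat_inner (Q_hat Q (0\<^sub>v n)) Y = (\<Sum>i<n. \<Sum>j<n. Q $$ (i, j) * Y $$ (Suc i, Suc j))"
  using assms
  by (simp add: mat_inner_def Q_hat_def sum.lessThan_Suc_shift del: sum.lessThan_Suc)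

text \<open>For the chosen instance the linear constraint of the relaxation is therefore
  vacuous.\<close>

lemma mat_inner_A_hat_zero: "mat_inner (A_hat (0\<^sub>m m n) (0\<^sub>v m)) Y = 0"
proof -
  have "mat_of_row (0\<^sub>v m) = (0\<^sub>m 1 m :: real mat)"
    by (rule eq_matI) (auto simp: mat_of_row_def)
  then have "A_hat (0\<^sub>m m n) (0\<^sub>v m) = 0\<^sub>m (1 + n) (1 + n)"
    by (intro eq_matI) (auto simp: A_hat_def)
  then show ?thesis
    by (simp add: mat_inner_def del: sum.lessThan_Suc)
qed

lemma lifted_inner:
  assumes "dim_vec x = n" "n \<ge> 5"
  shows "mat_inner (Q_hat (horn_mat n) (0\<^sub>v n)) (lifted x t)
    = (\<Sum>i<5. \<Sum>j<5. horn i j * (x $ i * x $ j)) - 95 * t"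
proof -
  have "mat_inner (Q_hat (horn_mat n) (0\<^sub>v n)) (lifted x t)
      = (\<Sum>i<n. \<Sum>j<n. horn i j * (x $ i * x $ j + t * dnn_cert i j))"
    using assms(1) by (subst mat_inner_Q_hat_zero) (auto simp: horn_mat_def lifted_def)
  also have "\<dots> = (\<Sum>i<5. \<Sum>j<5. horn i j * (x $ i * x $ j + t * dnn_cert i j))"
    by (rule horn_sum[OF assms(2)])
  also have "\<dots> = (\<Sum>i<5. \<Sum>j<5. horn i j * (x $ i * x $ j))
      + t * (\<Sum>i<5. \<Sum>j<5. horn i j * dnn_cert i j)"
    by (simp only: distrib_left sum.distrib sum_distrib_left mult.left_commute)
  finally show ?thesis by (simp add: horn_dnn_cert)
qed

lemma ereal_eq_MInfty_if_le_line:
  assumes "\<And>t. t \<ge> 0 \<Longrightarrow> z \<le> ereal (a - r * t)" "r > 0"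
  shows "z = -\<infinity>"
proof (rule ereal_bot)
  fix B
  \<comment> \<open>The solution \<open>t\<close> of \<open>a - r * t = B\<close>, clipped at 0 to
    stay admissible.\<close>
  have "a - r * (max 0 (a - B) / r) \<le> B"
    using assms(2) by (simp add: max_def)
  moreover have "z \<le> ereal (a - r * (max 0 (a - B) / r))"
    using assms(2) by (intro assms(1)) simp
  ultimately show "z \<le> ereal B"
    by (meson ereal_less_eq(3) order_trans)
qed

theorem proposition5p5:
  fixes n :: nat
  assumes "n \<ge> 5"
  shows "\<exists>m Q c A b. qp_instance n m Q c A b \<and>
           -\<infinity> < qp_value n Q c A b \<and> qp_value n Q c A b < \<infinity> \<and>
           (\<forall>x \<in> qp_feasible n A b. conic_value_at (doubly_nonneg (n + 1)) Q c A b x = -\<infinity>) \<and>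
           conic_value (doubly_nonneg (n + 1)) Q c A b = -\<infinity>"
proof -
  \<comment> \<open>A single zero row in \<open>A\<close>, because an instance requires
    \<open>m > 0\<close>.\<close>
  define Q c A b where "Q = horn_mat n" and "c = (0\<^sub>v n :: real vec)"
    and "A = (0\<^sub>m 1 n :: real mat)" and "b = (0\<^sub>v 1 :: real vec)"
  let ?K = "doubly_nonneg (n + 1)"
  have "transpose_mat Q = Q"
    by (rule eq_matI) (auto simp: Q_def horn_mat_def horn_def)
  then have inst: "qp_instance n 1 Q c A b"
    by (simp add: qp_instance_def Q_def c_def A_def b_def horn_mat_def)
  have feasible: "qp_feasible n A b = {x \<in> carrier_vec n. 0\<^sub>v n \<le> x}"
    by (auto simp: qp_feasible_def A_def b_def)
  have zero_feasible: "0\<^sub>v n \<in> qp_feasible n A b"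
    by (simp add: feasible)
  have "qp_objective Q c x \<ge> 0" if "x \<in> qp_feasible n A b" for x
  proof -
    have x: "x \<in> carrier_vec n" "0\<^sub>v n \<le> x"
      using that unfolding feasible by simp_all
    then have nonneg: "x $ i \<ge> 0" if "i < 5" for i
      using that assms unfolding less_eq_vec_def by (metis carrier_vecD index_zero_vec(1) less_le_trans)
    have "qp_objective Q c x = (\<Sum>i<n. \<Sum>j<n. horn i j * (x $ i * x $ j))"
      using x(1) by (simp add: qp_objective_def Q_def c_def horn_mat_def quadratic_form_mat)
    also have "\<dots> = (\<Sum>i<5. \<Sum>j<5. horn i j * (x $ i * x $ j))"
      by (rule horn_sum[OF assms])
    also have "\<dots> \<ge> 0"
      using nonneg by (rule horn_copositive)
    finally show ?thesis .
  qed
  then have "0 \<le> qp_value n Q c A b"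
    unfolding qp_value_def by (intro INF_greatest) simp
  then have bounded: "-\<infinity> < qp_value n Q c A b"
    by (rule less_le_trans[rotated]) simp
  have "qp_value n Q c A b \<le> ereal (qp_objective Q c (0\<^sub>v n))"
    unfolding qp_value_def by (rule INF_lower[OF zero_feasible])
  then have finite: "qp_value n Q c A b < \<infinity>"
    by (rule le_less_trans) simp
  have at: "conic_value_at ?K Q c A b x = -\<infinity>" if "x \<in> qp_feasible n A b" for x
  proof (rule ereal_eq_MInfty_if_le_line)
    fix t :: real
    assume t: "t \<ge> 0"
    have x: "dim_vec x = n" "0\<^sub>v n \<le> x"
      using that by (auto simp: feasible)
    have "lifted x t \<in> ?K"
      using lifted_doubly_nonneg[of x t] x t by simp
    \<comment> \<open>The multiple of D leaves row 0 untouched, so this row is \<open>(1, x)\<close>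
      for every \<open>t\<close>.\<close>
    then have "lifted x t \<in> conic_feasible_at ?K A b x"
      by (simp add: conic_feasible_at_def conic_feasible_def A_def b_def mat_inner_A_hat_zero)
        (simp add: lifted_def)
    then have "conic_value_at ?K Q c A b x \<le> ereal (mat_inner (Q_hat Q c) (lifted x t))"
      unfolding conic_value_at_def by (rule INF_lower)
    then show "conic_value_at ?K Q c A b x
        \<le> ereal ((\<Sum>i<5. \<Sum>j<5. horn i j * (x $ i * x $ j)) - 95 * t)"
      unfolding Q_def c_def lifted_inner[OF x(1) assms] .
  qed simp
  \<comment> \<open>Prescribing row 0 shrinks the feasible set, so the value at the origin bounds
    the unrestricted value from above.\<close>
  have "conic_value ?K Q c A b \<le> conic_value_at ?K Q c A b (0\<^sub>v n)"
    unfolding conic_value_def conic_value_at_def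
    by (rule INF_superset_mono) (auto simp: conic_feasible_at_def)
  then have "conic_value ?K Q c A b = -\<infinity>"
    using at[OF zero_feasible] by simp
  with inst bounded finite at show ?thesis by blast
qed

end
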